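(* Let $k=\mathbb{F}_q$ with $q\ge 5$ and let $E/k$ be an elliptic curve. Then there exists a $k$-complete biquadratic addition law on the Weierstrass model $E\subset\mathbb{P}^2$.
   Context: Let $\iota:E\hookrightarrow\mathbb{P}^2$ be the Weierstrass model (the embedding given by the complete linear system $|3(O)|$), $\mu$ the group law and $I_1\subset k[X_0,X_1,X_2]$, $I_2\subset k[Y_0,Y_1,Y_2]$ the homogeneous ideals of $\iota(E)$. An addition law of bidegree $(m,n)$ is a triple $(p_0,p_1,p_2)$ of elements of $k[X_0,X_1,X_2]/I_1\otimes k[Y_0,Y_1,Y_2]/I_2$, bihomogeneous of degree $m$ in the $X_i$ and $n$ in the $Y_i$, for which there is a nonempty open $U\subset E\times E$ with $\iota(\mu(x,y))=(p_0(\iota(x),\iota(y)):p_1(\iota(x),\iota(y)):p_2(\iota(x),\iota(y)))$ for all $(x,y)\in U(\bar k)$; the law is said to be defined on such $U$. "Biquadratic" means bidegree $(2,2)$. An addition law is $k$-complete if for every $(x,y)\in(E\times E)(k)$ it is defined on an open set containing $(x,y)$. *)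

theory Defs
  imports
    "HOL-Library.Cardinality"
    "HOL-Library.Poly_Mapping"
    "HOL-Library.Product_Plus"
    "HOL-Algebra.Algebraic_Closure_Type"
begin

section \<open>Elliptic curves in Weierstrass form\<close>

text \<open>
  The coefficients of $y^2 + a_1 xy + a_3 y = x^3 + a_2 x^2 + a_4 x + a_6$; this general form
  covers every characteristic.
\<close>

datatype 'a weierstrass = Weierstrass (a1: 'a) (a2: 'a) (a3: 'a) (a4: 'a) (a6: 'a)

type_synonym 'a vec3 = "'a \<times> 'a \<times> 'a"

fun cubic :: "'a::field weierstrass \<Rightarrow> 'a vec3 \<Rightarrow> 'a" where
  "cubic E (x, y, z) =
     y\<^sup>2 * z + a1 E * x * y * z + a3 E * y * z\<^sup>2
     - (x ^ 3 + a2 E * x\<^sup>2 * z + a4 E * x * z\<^sup>2 + a6 E * z ^ 3)"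

fun cubic_gradient :: "'a::field weierstrass \<Rightarrow> 'a vec3 \<Rightarrow> 'a vec3" where
  "cubic_gradient E (x, y, z) =
     (a1 E * y * z - (3 * x\<^sup>2 + 2 * a2 E * x * z + a4 E * z\<^sup>2),
      2 * y * z + a1 E * x * z + a3 E * z\<^sup>2,
      y\<^sup>2 + a1 E * x * y + 2 * a3 E * y * z - (a2 E * x\<^sup>2 + 2 * a4 E * x * z + 3 * a6 E * z\<^sup>2))"

abbreviation base_change :: "'k::field weierstrass \<Rightarrow> 'k alg_closure weierstrass" where
  "base_change E \<equiv> map_weierstrass to_ac E"

definition elliptic_curve :: "'k::field weierstrass \<Rightarrow> bool" where
  "elliptic_curve E \<longleftrightarrow>
     (\<forall>v. v \<noteq> (0, 0, 0) \<and> cubic (base_change E) v = 0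
          \<longrightarrow> cubic_gradient (base_change E) v \<noteq> (0, 0, 0))"

text \<open>
  The only point of the curve on the line $Z = 0$ is $O = (0:1:0)$. A point is therefore
  \<^term>\<open>None\<close>, standing for $O$, or \<^term>\<open>Some (x, y)\<close> with $(x, y)$ on the
  affine curve.
\<close>

type_synonym 'a pt = "('a \<times> 'a) option"

fun embed :: "'a::field pt \<Rightarrow> 'a vec3" where
  "embed None = (0, 1, 0)"
| "embed (Some (x, y)) = (x, y, 1)"

definition points :: "'a::field weierstrass \<Rightarrow> 'a pt set" where
  "points E = {P. cubic E (embed P) = 0}"

abbreviation to_ac_pt :: "'k::field pt \<Rightarrow> 'k alg_closure pt" where
  "to_ac_pt \<equiv> map_option (map_prod to_ac to_ac)"

text \<open>
  The chord-and-tangent law: \<open>l\<close> is the slope of the line through the two points, or of the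
  tangent if they coincide. Its third intersection point with the curve is then reflected by
  $(x, y) \mapsto (x, -y - a_1 x - a_3)$.
\<close>

fun add_pt :: "'a::field weierstrass \<Rightarrow> 'a pt \<Rightarrow> 'a pt \<Rightarrow> 'a pt" where
  "add_pt E None Q = Q"
| "add_pt E P None = P"
| "add_pt E (Some (x1, y1)) (Some (x2, y2)) =
     (if x1 = x2 \<and> y1 + y2 + a1 E * x2 + a3 E = 0 then None
      else
        let l = (if x1 = x2
                 then (3 * x1\<^sup>2 + 2 * a2 E * x1 + a4 E - a1 E * y1) / (2 * y1 + a1 E * x1 + a3 E)
                 else (y2 - y1) / (x2 - x1));
            x3 = l\<^sup>2 + a1 E * l - a2 E - x1 - x2;
            y3 = y1 + l * (x3 - x1)
        in Some (x3, - y3 - a1 E * x3 - a3 E))"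


section \<open>Bihomogeneous polynomials\<close>

text \<open>
  An element of $k[X_0,X_1,X_2,Y_0,Y_1,Y_2] = k[X_0,X_1,X_2] \otimes k[Y_0,Y_1,Y_2]$, as a finitely
  supported function of the exponents of the $X_i$ and of the $Y_i$.
\<close>

type_synonym 'k bipoly = "(nat vec3 \<times> nat vec3) \<Rightarrow>\<^sub>0 'k"

fun total_degree :: "nat vec3 \<Rightarrow> nat" where
  "total_degree (i, j, l) = i + j + l"

definition bihomogeneous :: "nat \<Rightarrow> nat \<Rightarrow> 'k::field bipoly \<Rightarrow> bool" where
  "bihomogeneous m n f \<longleftrightarrow>
     (\<forall>(d, e) \<in> Poly_Mapping.keys f. total_degree d = m \<and> total_degree e = n)"

fun monomial_value :: "'a::field vec3 \<Rightarrow> nat vec3 \<Rightarrow> 'a" where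
  "monomial_value (x, y, z) (i, j, l) = x ^ i * y ^ j * z ^ l"

definition bieval :: "'k::field bipoly \<Rightarrow> 'k alg_closure vec3 \<Rightarrow> 'k alg_closure vec3 \<Rightarrow> 'k alg_closure"
  where
  "bieval f v w =
     (\<Sum>(d, e) \<in> Poly_Mapping.keys f.
        to_ac (Poly_Mapping.lookup f (d, e)) * monomial_value v d * monomial_value w e)"


section \<open>Addition laws\<close>

text \<open>Equality of points of the projective plane; a zero vector represents no point.\<close>

definition proj_eq :: "'a::field vec3 \<Rightarrow> 'a vec3 \<Rightarrow> bool" where
  "proj_eq u v \<longleftrightarrow>
     u \<noteq> (0, 0, 0) \<and> v \<noteq> (0, 0, 0) \<and>
     (\<exists>c. c \<noteq> 0 \<and> u = (case v of (x, y, z) \<Rightarrow> (c * x, c * y, c * z)))"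

text \<open>
  An open subset of the \<open>k\<close>-scheme $E \times E$ is identified with its set of geometric points:
  the complement of the common zeros of a set of bihomogeneous polynomials over \<open>k\<close>.
\<close>

definition zariski_open :: "'k::field weierstrass \<Rightarrow> ('k alg_closure pt \<times> 'k alg_closure pt) set \<Rightarrow> bool"
  where
  "zariski_open E U \<longleftrightarrow>
     (\<exists>S. (\<forall>f\<in>S. \<exists>m n. bihomogeneous m n f) \<and>
          U = {(P, Q) \<in> points (base_change E) \<times> points (base_change E).
                 \<exists>f\<in>S. bieval f (embed P) (embed Q) \<noteq> 0})"

definition defined_on ::
  "'k::field weierstrass \<Rightarrow> 'k bipoly vec3 \<Rightarrow> ('k alg_closure pt \<times> 'k alg_closure pt) set \<Rightarrow> bool"
  where
  "defined_on E p U \<longleftrightarrow>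
     zariski_open E U \<and> U \<noteq> {} \<and>
     (\<forall>(P, Q) \<in> U.
        case p of (p0, p1, p2) \<Rightarrow>
          proj_eq (embed (add_pt (base_change E) P Q))
            (bieval p0 (embed P) (embed Q),
             bieval p1 (embed P) (embed Q),
             bieval p2 (embed P) (embed Q)))"

text \<open>
  The components of a law are classes modulo the ideals of the curve in the $X_i$ and in the
  $Y_i$. As these ideals are homogeneous, every bihomogeneous class has a bihomogeneous
  representative of the same bidegree, and laws are given here by such representatives. Whether
  \<^term>\<open>defined_on\<close> holds does not depend on the choice, as only values at points of the
  curve enter.
\<close>

definition addition_law :: "'k::field weierstrass \<Rightarrow> nat \<Rightarrow> nat \<Rightarrow> 'k bipoly vec3 \<Rightarrow> bool" where
  "addition_law E m n p \<longleftrightarrow>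
     (case p of (p0, p1, p2) \<Rightarrow>
        bihomogeneous m n p0 \<and> bihomogeneous m n p1 \<and> bihomogeneous m n p2) \<and>
     (\<exists>U. defined_on E p U)"

definition complete_law :: "'k::field weierstrass \<Rightarrow> 'k bipoly vec3 \<Rightarrow> bool" where
  "complete_law E p \<longleftrightarrow>
     (\<forall>P \<in> points E. \<forall>Q \<in> points E. \<exists>U. defined_on E p U \<and> (to_ac_pt P, to_ac_pt Q) \<in> U)"

end

theory Submission
  imports Defs
begin

text \<open>
  There is a $3 \times 3$ matrix of biquadratic forms whose value at $(P, Q)$ is a nonzero multiple of
  $(P + Q)(P - Q)^T$, for all $P, Q \in E(\bar k)$. Multiplying it by the coefficient vector of a
  line gives an addition law that is defined at $(P, Q)$ exactly if $P - Q$ is not on the line, hence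
  it suffices to find a line over $k$ that misses $E(k)$. The point $O$ is avoided by the $q^2$ lines
  $y = mx + c$. If each of them met $E(k)$, the number $r$ of its affine rational points would be
  1, 2 or 3 and $(r - 1)(r - 3) \le 0$; but double counting shows that the sum of $(r - 1)(r - 3)$
  over these lines is at least $n^2 - (3q + 2)n + 3q^2$, where $n$ is the number of affine rational
  points, and this is positive for all $n$ if $q \ge 5$.
\<close>

section \<open>Lines missing a plane curve\<close>

text \<open>A second-moment count over the \<open>q^2\<close> pairs \<open>(m, c)\<close>, for an
  arbitrary point set subject to the intersection bounds of a Weierstrass cubic. Here
  \<open>r s\<close> counts the points of \<open>A\<close> on the line with slope and intercept
  \<open>s\<close>.\<close>

lemma exists_missing_line:
  fixes A :: "('k::{field, finite} \<times> 'k) set"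
  assumes q: "CARD('k) \<ge> 5"
    and line: "\<And>m c. card {p \<in> A. snd p = m * fst p + c} \<le> 3"
    and vert: "\<And>x. card {p \<in> A. fst p = x} \<le> 2"
  shows "\<exists>m c. \<forall>x. (x, m * x + c) \<notin> A"
proof (rule ccontr)
  assume contra: "\<nexists>m c. \<forall>x. (x, m * x + c) \<notin> A"
  define on :: "'k \<times> 'k \<Rightarrow> 'k \<times> 'k \<Rightarrow> bool" where "on p s \<longleftrightarrow> snd p = fst s * fst p + snd s" for p s
  define r :: "'k \<times> 'k \<Rightarrow> int" where "r s = (\<Sum>p\<in>A. of_bool (on p s))" for s
  define q n :: int where "q = int CARD('k)" and "n = int (card A)"
  have fin [simp]: "finite (B :: ('k \<times> 'k) set)" for B by (rule finite)
  have r_card: "r s = int (card {p \<in> A. snd p = fst s * fst p + snd s})" for s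
    by (simp add: r_def on_def sum.If_cases of_bool_def Int_def)
  have r_range: "1 \<le> r s" "r s \<le> 3" for s
  proof -
    obtain x where "(x, fst s * x + snd s) \<in> A" using contra by blast
    hence "{p \<in> A. snd p = fst s * fst p + snd s} \<noteq> {}" by force
    thus "1 \<le> r s" unfolding r_card by (simp add: Suc_le_eq card_gt_0_iff)
    show "r s \<le> 3" unfolding r_card using line[of "fst s" "snd s"] by simp
  qed
  have through: "(\<Sum>s\<in>UNIV. of_bool (on p s)) = q" for p
  proof -
    have "{s. on p s} = (\<lambda>m. (m, snd p - m * fst p)) ` UNIV"
      by (auto simp: on_def image_iff algebra_simps prod_eq_iff)
    moreover have "inj (\<lambda>m. (m, snd p - m * fst p))" by (auto intro: injI)
    ultimately have "card {s. on p s} = CARD('k)" by (simp add: card_image)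
    thus ?thesis by (simp add: q_def of_bool_def sum.If_cases)
  qed
  have joining: "1 \<le> (\<Sum>s\<in>UNIV. of_bool (on p s \<and> on p' s) :: int)" if "fst p \<noteq> fst p'" for p p'
  proof -
    define m where "m = (snd p - snd p') / (fst p - fst p')"
    have "m * (fst p - fst p') = snd p - snd p'" using that by (simp add: m_def)
    hence "on p (m, snd p - m * fst p)" "on p' (m, snd p - m * fst p)"
      by (auto simp: on_def algebra_simps)
    hence "{s. on p s \<and> on p' s} \<noteq> {}" by blast
    thus ?thesis by (simp add: of_bool_def sum.If_cases Suc_le_eq card_gt_0_iff)
  qed
  have "(\<Sum>s\<in>UNIV. r s) = n * q"
    unfolding r_def by (subst sum.swap) (simp add: through n_def)
  moreover have "(\<Sum>s\<in>UNIV. (r s)\<^sup>2) \<ge> n * (q + n - 2)"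
  proof -
    \<comment> \<open>For fixed \<open>p\<close>, the term \<open>p' = p\<close> contributes
      \<open>q\<close>, and every \<open>p'\<close> off the vertical line through \<open>p\<close>
      contributes at least 1. The vertical line accounts for at most 2 of the \<open>n\<close>
      points.\<close>
    have "q + n - 2 \<le> (\<Sum>p'\<in>A. \<Sum>s\<in>UNIV. of_bool (on p s \<and> on p' s))" if "p \<in> A" for p
    proof -
      let ?f = "\<lambda>p'. \<Sum>s\<in>UNIV. of_bool (on p s \<and> on p' s) :: int"
      let ?V = "{p' \<in> A. fst p' = fst p}"
      have "card ?V \<le> card A" by (intro card_mono) auto
      hence "n = int (card ?V) + int (card (A - ?V))"
        unfolding n_def by (subst card_Diff_subset) auto
      moreover have "int (card ?V) \<le> 2" using vert[of "fst p"] by simp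
      moreover have "int (card (A - ?V)) \<le> (\<Sum>p'\<in>A - ?V. ?f p')"
      proof -
        have "(\<Sum>p'\<in>A - ?V. 1) \<le> (\<Sum>p'\<in>A - ?V. ?f p')"
          by (intro sum_mono joining) auto
        thus ?thesis by simp
      qed
      moreover have "q \<le> (\<Sum>p'\<in>?V. ?f p')"
      proof -
        have "q = ?f p" by (simp add: through)
        also have "\<dots> \<le> (\<Sum>p'\<in>?V. ?f p')"
          by (rule member_le_sum) (use that in \<open>auto intro: sum_nonneg\<close>)
        finally show ?thesis .
      qed
      moreover have "(\<Sum>p'\<in>A. ?f p') = (\<Sum>p'\<in>A - ?V. ?f p') + (\<Sum>p'\<in>?V. ?f p')"
        by (rule sum.subset_diff) auto
      ultimately show ?thesis by linarith
    qed
    hence "(\<Sum>p\<in>A. q + n - 2) \<le> (\<Sum>p\<in>A. \<Sum>p'\<in>A. \<Sum>s\<in>UNIV. of_bool (on p s \<and> on p' s))"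
      by (intro sum_mono)
    also have "\<dots> = (\<Sum>p\<in>A. \<Sum>s\<in>UNIV. \<Sum>p'\<in>A. of_bool (on p s \<and> on p' s))"
      by (intro sum.cong refl sum.swap)
    also have "\<dots> = (\<Sum>s\<in>UNIV. \<Sum>p\<in>A. \<Sum>p'\<in>A. of_bool (on p s \<and> on p' s))"
      by (rule sum.swap)
    also have "\<dots> = (\<Sum>s\<in>UNIV. (r s)\<^sup>2)"
      by (simp only: r_def power2_eq_square sum_product of_bool_conj)
    finally show ?thesis by (simp add: n_def)
  qed
  \<comment> \<open>Each summand is \<open>(r s - 1) * (r s - 3)\<close>, which is at most 0 for
    \<open>r s\<close> between 1 and 3.\<close>
  moreover have "(\<Sum>s\<in>UNIV. (r s)\<^sup>2 - 4 * r s + 3) \<le> 0"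
  proof (rule sum_nonpos)
    fix s
    have "(r s - 1) * (r s - 3) \<le> 0" using r_range[of s] by (intro mult_nonneg_nonpos) auto
    thus "(r s)\<^sup>2 - 4 * r s + 3 \<le> 0" by (simp add: power2_eq_square algebra_simps)
  qed
  ultimately have "n * (q + n - 2) - 4 * (n * q) + 3 * q\<^sup>2 \<le> 0"
    by (simp add: sum.distrib sum_subtractf sum_distrib_left[symmetric] q_def power2_eq_square)
  \<comment> \<open>The factor 4 completes the square in \<open>n\<close> over the integers. The
    remainder \<open>3 q^2 - 12 q - 4\<close> is -4 at \<open>q = 4\<close> and 11 at
    \<open>q = 5\<close>; the written form makes its sign evident for \<open>q >= 5\<close>.\<close>
  hence "4 * (n * (q + n - 2) - 4 * (n * q) + 3 * q\<^sup>2) \<le> 0" by simp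
  also have "4 * (n * (q + n - 2) - 4 * (n * q) + 3 * q\<^sup>2)
      = (2 * n - 3 * q - 2)\<^sup>2 + (3 * ((q - 5) * (q + 1)) + 11)"
    by (simp add: power2_eq_square algebra_simps)
  finally have "(2 * n - 3 * q - 2)\<^sup>2 + (3 * ((q - 5) * (q + 1)) + 11) \<le> 0" .
  moreover have "q \<ge> 5" using q by (simp add: q_def)
  hence "(2 * n - 3 * q - 2)\<^sup>2 + (3 * ((q - 5) * (q + 1)) + 11) > 0"
    by (intro add_nonneg_pos zero_le_power2 mult_nonneg_nonneg) auto
  ultimately show False by linarith
qed

section \<open>Intersections of a Weierstrass cubic with lines\<close>

lemma card_cubic_roots_le:
  "card {x::'a::idom. x ^ 3 + a * x\<^sup>2 + b * x + c = 0} \<le> 3"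
proof -
  have "card {x. poly [:c, b, a, 1:] x = 0} \<le> degree [:c, b, a, 1:]"
    by (rule card_poly_roots_bound) simp
  thus ?thesis by (simp add: algebra_simps power2_eq_square power3_eq_cube)
qed

lemma card_quadratic_roots_le:
  "card {x::'a::idom. x\<^sup>2 + b * x + c = 0} \<le> 2"
proof -
  have "card {x. poly [:c, b, 1:] x = 0} \<le> degree [:c, b, 1:]"
    by (rule card_poly_roots_bound) simp
  thus ?thesis by (simp add: algebra_simps power2_eq_square)
qed

lemma exists_line_missing_curve:
  fixes E :: "'k::{field, finite} weierstrass"
  assumes "CARD('k) \<ge> 5"
  shows "\<exists>m c. \<forall>x. Some (x, m * x + c) \<notin> points E"
proof -
  let ?A = "{(x, y). Some (x, y) \<in> points E}"
  have "\<exists>m c. \<forall>x. (x, m * x + c) \<notin> ?A"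
  proof (rule exists_missing_line[OF assms])
    fix m c
    \<comment> \<open>Substituting \<open>y = m x + c\<close> into the affine equation leaves a
      monic cubic in \<open>x\<close>; for a vertical line the equation is a monic quadratic in
      \<open>y\<close>.\<close>
    let ?R = "{x. x ^ 3 + (a2 E - m\<^sup>2 - a1 E * m) * x\<^sup>2 + (a4 E - 2 * m * c - a1 E * c - a3 E * m) * x
      + (a6 E - c\<^sup>2 - a3 E * c) = 0}"
    have "{p \<in> ?A. snd p = m * fst p + c} \<subseteq> (\<lambda>x. (x, m * x + c)) ` ?R"
      by (auto simp: points_def image_iff algebra_simps power2_eq_square power3_eq_cube)
    hence "card {p \<in> ?A. snd p = m * fst p + c} \<le> card ?R"
      by (rule surj_card_le[rotated]) simp
    also have "\<dots> \<le> 3" by (rule card_cubic_roots_le)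
    finally show "card {p \<in> ?A. snd p = m * fst p + c} \<le> 3" .
  next
    fix x
    let ?R = "{y. y\<^sup>2 + (a1 E * x + a3 E) * y + - (x ^ 3 + a2 E * x\<^sup>2 + a4 E * x + a6 E) = 0}"
    have "{p \<in> ?A. fst p = x} \<subseteq> (\<lambda>y. (x, y)) ` ?R"
      by (auto simp: points_def image_iff algebra_simps power2_eq_square power3_eq_cube)
    hence "card {p \<in> ?A. fst p = x} \<le> card ?R"
      by (rule surj_card_le[rotated]) simp
    also have "\<dots> \<le> 2" by (rule card_quadratic_roots_le)
    finally show "card {p \<in> ?A. fst p = x} \<le> 2" .
  qed
  thus ?thesis by simp
qed

section \<open>The matrix of biquadratic forms\<close>

text \<open>The classical quantity b_8 of a Weierstrass equation, the constant term of its
  3-division polynomial.\<close>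

definition b8 :: "'a::field weierstrass \<Rightarrow> 'a" where
  "b8 E = a1 E ^ 2 * a6 E + 4 * a2 E * a6 E - a1 E * a3 E * a4 E + a2 E * a3 E ^ 2 - a4 E ^ 2"

text \<open>
  \<open>sd_ij\<close> is the entry in row \<open>i\<close>, column \<open>j\<close> of a matrix proportional to
  $(P + Q)(P - Q)^T$, with factor $(x_1 - x_2)^3$ at affine points with $x_1 \ne x_2$. The
  coefficients were found by linear algebra, as each entry is a unique combination of the products
  of $1, x_1, y_1, x_1^2, x_1 y_1, y_1^2$ and $1, x_2, y_2, x_2^2, x_2 y_2, y_2^2$. The entries below
  the diagonal come from those above it by $Q \mapsto -Q$, which swaps $P + Q$ and $P - Q$.
\<close>

fun sd_xx :: "'a::field weierstrass \<Rightarrow> 'a vec3 \<Rightarrow> 'a vec3 \<Rightarrow> 'a" where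
  "sd_xx E (x1, y1, z1) (x2, y2, z2) =
     b8 E * z1 ^ 2 * x2 * z2 + (3 * a6 E + a3 E ^ 2) * z1 ^ 2 * x2 ^ 2
     + (a4 E + a1 E * a3 E) * x1 * z1 * x2 ^ 2 + a3 E * y1 * z1 * x2 ^ 2
     + a1 E * x1 * y1 * x2 ^ 2 + y1 ^ 2 * x2 ^ 2 - b8 E * x1 * z1 * z2 ^ 2
     - (3 * a6 E + a3 E ^ 2) * x1 ^ 2 * z2 ^ 2 - (a4 E + a1 E * a3 E) * x1 ^ 2 * x2 * z2
     - a3 E * x1 ^ 2 * y2 * z2 - a1 E * x1 ^ 2 * x2 * y2 - x1 ^ 2 * y2 ^ 2"

fun sd_xy :: "'a::field weierstrass \<Rightarrow> 'a vec3 \<Rightarrow> 'a vec3 \<Rightarrow> 'a" where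
  "sd_xy E (x1, y1, z1) (x2, y2, z2) =
     a3 E * b8 E * z1 ^ 2 * z2 ^ 2 + (6 * a3 E * a6 E + a3 E ^ 3) * z1 ^ 2 * x2 * z2
     + b8 E * z1 ^ 2 * y2 * z2 + a3 E * a4 E * z1 ^ 2 * x2 ^ 2 + 3 * a6 E * z1 ^ 2 * x2 * y2
     + (3 * a3 E * a6 E + a3 E ^ 3 + a1 E * b8 E) * x1 * z1 * z2 ^ 2
     + (2 * a3 E * a4 E + 6 * a1 E * a6 E + 2 * a1 E * a3 E ^ 2) * x1 * z1 * x2 * z2
     + (6 * a6 E + 2 * a3 E ^ 2) * x1 * z1 * y2 * z2
     + (a2 E * a3 E + a1 E * a4 E) * x1 * z1 * x2 ^ 2 + 2 * a4 E * x1 * z1 * x2 * y2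
     + b8 E * y1 * z1 * z2 ^ 2 + 6 * a6 E * y1 * z1 * x2 * z2
     + (a4 E - a1 E * a3 E) * y1 * z1 * x2 ^ 2
     + (3 * a1 E * a6 E + a1 E * a3 E ^ 2) * x1 ^ 2 * z2 ^ 2
     + (2 * a1 E * a4 E + a1 E ^ 2 * a3 E) * x1 ^ 2 * x2 * z2
     + (a4 E + a1 E * a3 E) * x1 ^ 2 * y2 * z2 + a1 E * a2 E * x1 ^ 2 * x2 ^ 2
     + a2 E * x1 ^ 2 * x2 * y2 + (3 * a6 E + a3 E ^ 2) * x1 * y1 * z2 ^ 2
     + 2 * a4 E * x1 * y1 * x2 * z2 + (a2 E - a1 E ^ 2) * x1 * y1 * x2 ^ 2
     - 2 * a3 E * y1 * z1 * x2 * y2 - 2 * a1 E * x1 * y1 * x2 * y2 - x1 * y1 * y2 ^ 2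
     - a3 E * y1 ^ 2 * x2 * z2 - a1 E * y1 ^ 2 * x2 ^ 2 - y1 ^ 2 * x2 * y2"

fun sd_xz :: "'a::field weierstrass \<Rightarrow> 'a vec3 \<Rightarrow> 'a vec3 \<Rightarrow> 'a" where
  "sd_xz E (x1, y1, z1) (x2, y2, z2) =
     a3 E * z1 ^ 2 * x2 * y2 + 3 * a6 E * x1 * z1 * z2 ^ 2 + 2 * a3 E * y1 * z1 * x2 * z2
     + a1 E * y1 * z1 * x2 ^ 2 + 2 * y1 * z1 * x2 * y2 + a4 E * x1 ^ 2 * z2 ^ 2
     + a2 E * x1 ^ 2 * x2 * z2 + y1 ^ 2 * x2 * z2 - 3 * a6 E * z1 ^ 2 * x2 * z2
     - a4 E * z1 ^ 2 * x2 ^ 2 - 2 * a3 E * x1 * z1 * y2 * z2 - a2 E * x1 * z1 * x2 ^ 2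
     - x1 * z1 * y2 ^ 2 - a1 E * x1 ^ 2 * y2 * z2 - a3 E * x1 * y1 * z2 ^ 2
     - 2 * x1 * y1 * y2 * z2"

fun sd_yy :: "'a::field weierstrass \<Rightarrow> 'a vec3 \<Rightarrow> 'a vec3 \<Rightarrow> 'a" where
  "sd_yy E (x1, y1, z1) (x2, y2, z2) =
     ((3 * a6 E + a3 E ^ 2) ^ 2 - (a4 E + a1 E * a3 E) * b8 E) * z1 ^ 2 * z2 ^ 2
     + (3 * a4 E * a6 E + 2 * a3 E ^ 2 * a4 E - 3 * a1 E * a3 E * a6 E - a2 E * b8 E)
       * z1 ^ 2 * x2 * z2
     + (a4 E ^ 2 - 3 * a2 E * a6 E) * z1 ^ 2 * x2 ^ 2
     + ((a4 E + a1 E * a3 E) * (3 * a6 E + a3 E ^ 2) - (a2 E + a1 E ^ 2) * b8 E) * x1 * z1 * z2 ^ 2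
     + (4 * a4 E ^ 2 + 4 * a1 E * a3 E * a4 E - 12 * a2 E * a6 E
        - 2 * a2 E * a3 E ^ 2 - 6 * a1 E ^ 2 * a6 E)
       * x1 * z1 * x2 * z2
     + (a2 E * a4 E - 9 * a6 E) * x1 * z1 * x2 ^ 2
     + (3 * a3 E * a6 E + a3 E ^ 3 - a1 E * b8 E) * y1 * z1 * z2 ^ 2
     + (2 * a3 E * a4 E - 6 * a1 E * a6 E) * y1 * z1 * x2 * z2
     + (a2 E * a3 E - a1 E * a4 E) * y1 * z1 * x2 ^ 2
     + (a4 E ^ 2 + 2 * a1 E * a3 E * a4 E - 3 * a2 E * a6 E - a2 E * a3 E ^ 2
        - 3 * a1 E ^ 2 * a6 E)
       * x1 ^ 2 * z2 ^ 2
     + (a2 E * a4 E + 2 * a1 E * a2 E * a3 E - 9 * a6 E - 3 * a3 E ^ 2 - a1 E ^ 2 * a4 E)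
       * x1 ^ 2 * x2 * z2
     + (a2 E ^ 2 - 3 * a4 E) * x1 ^ 2 * x2 ^ 2
     + (a3 E * a4 E - 3 * a1 E * a6 E) * x1 * y1 * z2 ^ 2
     + (2 * a2 E * a3 E - 2 * a1 E * a4 E) * x1 * y1 * x2 * z2
     + (3 * a3 E - a1 E * a2 E) * x1 * y1 * x2 ^ 2 - a3 E * y1 ^ 2 * y2 * z2
     - a1 E * y1 ^ 2 * x2 * y2 - y1 ^ 2 * y2 ^ 2"

fun sd_yz :: "'a::field weierstrass \<Rightarrow> 'a vec3 \<Rightarrow> 'a vec3 \<Rightarrow> 'a" where
  "sd_yz E (x1, y1, z1) (x2, y2, z2) =
     (3 * a1 E * a6 E - a3 E * a4 E) * z1 ^ 2 * x2 * z2
     + (3 * a6 E + a3 E ^ 2) * z1 ^ 2 * y2 * z2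
     + (a1 E * a4 E - a2 E * a3 E) * z1 ^ 2 * x2 ^ 2 + a4 E * z1 ^ 2 * x2 * y2
     + (a3 E * a4 E - 3 * a1 E * a6 E) * x1 * z1 * z2 ^ 2
     + (2 * a4 E + 2 * a1 E * a3 E) * x1 * z1 * y2 * z2
     + (a1 E * a2 E - 3 * a3 E) * x1 * z1 * x2 ^ 2 + 2 * a2 E * x1 * z1 * x2 * y2
     + (a2 E * a3 E - a1 E * a4 E) * x1 ^ 2 * z2 ^ 2
     + (3 * a3 E - a1 E * a2 E) * x1 ^ 2 * x2 * z2 + (a2 E + a1 E ^ 2) * x1 ^ 2 * y2 * z2
     + 3 * x1 ^ 2 * x2 * y2 + 2 * a1 E * x1 * y1 * y2 * z2 + y1 ^ 2 * y2 * z2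
     - (3 * a6 E + a3 E ^ 2) * y1 * z1 * z2 ^ 2
     - (2 * a4 E + 2 * a1 E * a3 E) * y1 * z1 * x2 * z2
     - (a2 E + a1 E ^ 2) * y1 * z1 * x2 ^ 2 - 2 * a1 E * y1 * z1 * x2 * y2
     - y1 * z1 * y2 ^ 2 - a4 E * x1 * y1 * z2 ^ 2 - 2 * a2 E * x1 * y1 * x2 * z2
     - 3 * x1 * y1 * x2 ^ 2"

fun sd_zz :: "'a::field weierstrass \<Rightarrow> 'a vec3 \<Rightarrow> 'a vec3 \<Rightarrow> 'a" where
  "sd_zz E (x1, y1, z1) (x2, y2, z2) =
     a4 E * z1 ^ 2 * x2 * z2 + a2 E * z1 ^ 2 * x2 ^ 2 + 3 * x1 * z1 * x2 ^ 2
     + a3 E * y1 * z1 * z2 ^ 2 + a1 E * x1 * y1 * z2 ^ 2 + y1 ^ 2 * z2 ^ 2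
     - a3 E * z1 ^ 2 * y2 * z2 - a1 E * z1 ^ 2 * x2 * y2 - z1 ^ 2 * y2 ^ 2
     - a4 E * x1 * z1 * z2 ^ 2 - a2 E * x1 ^ 2 * z2 ^ 2 - 3 * x1 ^ 2 * x2 * z2"

text \<open>Negation in homogeneous coordinates. Being linear, it preserves bidegree (2,2) when
  substituted for the second argument of an entry.\<close>

fun neg_vec :: "'a::field weierstrass \<Rightarrow> 'a vec3 \<Rightarrow> 'a vec3" where
  "neg_vec E (x, y, z) = (x, - y - a1 E * x - a3 E * z, z)"

fun neg_pt :: "'a::field weierstrass \<Rightarrow> 'a pt \<Rightarrow> 'a pt" where
  "neg_pt E None = None"
| "neg_pt E (Some (x, y)) = Some (x, - y - a1 E * x - a3 E)"

section \<open>Chords: \<open>P + Q\<close> and \<open>P - Q\<close> for distinct abscissas\<close>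

context
  fixes E :: "'a::field weierstrass" and x1 y1 x2 y2 l m :: 'a and x3 y3 x4 y4 :: 'a
  assumes P: "cubic E (x1, y1, 1) = 0" and Q: "cubic E (x2, y2, 1) = 0" and "x1 \<noteq> x2"
    and l: "l = (y2 - y1) / (x2 - x1)" and m: "m = (- y2 - a1 E * x2 - a3 E - y1) / (x2 - x1)"
    and x3: "x3 = l\<^sup>2 + a1 E * l - a2 E - x1 - x2"
    and y3: "y3 = - (y1 + l * (x3 - x1)) - a1 E * x3 - a3 E"
    and x4: "x4 = m\<^sup>2 + a1 E * m - a2 E - x1 - x2"
    and y4: "y4 = - (y1 + m * (x4 - x1)) - a1 E * x4 - a3 E"
begin

text \<open>
  Taking the slopes \<open>l\<close> and \<open>m\<close> as parameters makes the remaining data polynomial, so that the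
  claims about the chord become polynomial identities without side conditions.
\<close>

lemma chord_parametrization:
  obtains d b1 b2 where "d \<noteq> 0" "x2 = x1 + d" "y2 = y1 + l * d"
    "E = (let b3 = - 2 * y1 - (l + m) * d - b1 * (x1 + d);
              b4 = l * (2 * y1 + l * d + b3) + b1 * (y1 + l * d + x1 * l)
                - ((x1 + d)\<^sup>2 + x1 * (x1 + d) + x1\<^sup>2) - b2 * (2 * x1 + d)
          in Weierstrass b1 b2 b3 b4
              (y1\<^sup>2 + b1 * x1 * y1 + b3 * y1 - x1 ^ 3 - b2 * x1\<^sup>2 - b4 * x1))"
proof -
  obtain b1 b2 b3 b4 b6 where E: "E = Weierstrass b1 b2 b3 b4 b6" by (cases E)
  define d where "d = x2 - x1"
  have d: "d \<noteq> 0" "x2 = x1 + d" using \<open>x1 \<noteq> x2\<close> by (auto simp: d_def)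
  have y2: "y2 = y1 + l * d" using d by (simp add: l)
  \<comment> \<open>Three constraints are solved for coefficients: the slope \<open>m\<close> of the
    line through P and -Q gives \<open>b3\<close>, the equation at P gives \<open>b6\<close>, and
    the difference of the two equations, divided by \<open>d\<close>, gives
    \<open>b4\<close>.\<close>
  have "m * d = - y2 - b1 * x2 - b3 - y1" using d by (simp add: m E)
  hence "b3 = - y2 - b1 * x2 - y1 - m * d" by simp
  also have "\<dots> = - 2 * y1 - (l + m) * d - b1 * (x1 + d)" by (simp add: d y2 algebra_simps)
  finally have b3: "b3 = - 2 * y1 - (l + m) * d - b1 * (x1 + d)" .
  have b6: "b6 = y1\<^sup>2 + b1 * x1 * y1 + b3 * y1 - x1 ^ 3 - b2 * x1\<^sup>2 - b4 * x1"
    using P by (simp add: E algebra_simps)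
  have "d * (l * (2 * y1 + l * d + b3) + b1 * (y1 + l * d + x1 * l)
      - ((x1 + d)\<^sup>2 + x1 * (x1 + d) + x1\<^sup>2) - b2 * (2 * x1 + d)) - d * b4
      = cubic E (x2, y2, 1) - cubic E (x1, y1, 1)"
    unfolding d y2 E by (simp add: algebra_simps power2_eq_square power3_eq_cube)
  hence "b4 = l * (2 * y1 + l * d + b3) + b1 * (y1 + l * d + x1 * l)
      - ((x1 + d)\<^sup>2 + x1 * (x1 + d) + x1\<^sup>2) - b2 * (2 * x1 + d)"
    using P Q d(1) by (simp del: cubic.simps)
  thus ?thesis using that[of d b1 b2] d y2 E b3 b6 by (simp add: Let_def)
qed

text \<open>Here \<open>(x3, y3)\<close> is P + Q and \<open>(x4, y4)\<close> is P - Q. After the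
  parametrization, each claim is a polynomial identity in \<open>x1\<close>, \<open>y1\<close>,
  \<open>d\<close>, \<open>l\<close>, \<open>m\<close>, \<open>b1\<close>,
  \<open>b2\<close>.\<close>

lemma sd_chord:
  "sd_xx E (x1, y1, 1) (x2, y2, 1) = (x1 - x2) ^ 3 * x3 * x4"
  "sd_xy E (x1, y1, 1) (x2, y2, 1) = (x1 - x2) ^ 3 * x3 * y4"
  "sd_xz E (x1, y1, 1) (x2, y2, 1) = (x1 - x2) ^ 3 * x3"
  "sd_yy E (x1, y1, 1) (x2, y2, 1) = (x1 - x2) ^ 3 * y3 * y4"
  "sd_yz E (x1, y1, 1) (x2, y2, 1) = (x1 - x2) ^ 3 * y3"
  "sd_zz E (x1, y1, 1) (x2, y2, 1) = (x1 - x2) ^ 3"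
proof -
  obtain d b1 b2 where *: "d \<noteq> 0" "x2 = x1 + d" "y2 = y1 + l * d"
    "E = (let b3 = - 2 * y1 - (l + m) * d - b1 * (x1 + d);
              b4 = l * (2 * y1 + l * d + b3) + b1 * (y1 + l * d + x1 * l)
                - ((x1 + d)\<^sup>2 + x1 * (x1 + d) + x1\<^sup>2) - b2 * (2 * x1 + d)
          in Weierstrass b1 b2 b3 b4
              (y1\<^sup>2 + b1 * x1 * y1 + b3 * y1 - x1 ^ 3 - b2 * x1\<^sup>2 - b4 * x1))"
    using chord_parametrization .
  note eqs = *(2-4)[unfolded Let_def] x3 y3 x4 y4 b8_def
  show "sd_xx E (x1, y1, 1) (x2, y2, 1) = (x1 - x2) ^ 3 * x3 * x4"
    unfolding sd_xx.simps eqs weierstrass.sel power_one mult_1_right by Groebner_Basis.algebra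
  show "sd_xy E (x1, y1, 1) (x2, y2, 1) = (x1 - x2) ^ 3 * x3 * y4"
    unfolding sd_xy.simps eqs weierstrass.sel power_one mult_1_right by Groebner_Basis.algebra
  show "sd_xz E (x1, y1, 1) (x2, y2, 1) = (x1 - x2) ^ 3 * x3"
    unfolding sd_xz.simps eqs weierstrass.sel power_one mult_1_right by Groebner_Basis.algebra
  show "sd_yy E (x1, y1, 1) (x2, y2, 1) = (x1 - x2) ^ 3 * y3 * y4"
    unfolding sd_yy.simps eqs weierstrass.sel power_one mult_1_right by Groebner_Basis.algebra
  show "sd_yz E (x1, y1, 1) (x2, y2, 1) = (x1 - x2) ^ 3 * y3"
    unfolding sd_yz.simps eqs weierstrass.sel power_one mult_1_right by Groebner_Basis.algebra
  show "sd_zz E (x1, y1, 1) (x2, y2, 1) = (x1 - x2) ^ 3"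
    unfolding sd_zz.simps eqs weierstrass.sel power_one mult_1_right by Groebner_Basis.algebra
qed

lemma cubic_chord: "cubic E (x3, y3, 1) = 0"
proof -
  obtain d b1 b2 where *: "d \<noteq> 0" "x2 = x1 + d" "y2 = y1 + l * d"
    "E = (let b3 = - 2 * y1 - (l + m) * d - b1 * (x1 + d);
              b4 = l * (2 * y1 + l * d + b3) + b1 * (y1 + l * d + x1 * l)
                - ((x1 + d)\<^sup>2 + x1 * (x1 + d) + x1\<^sup>2) - b2 * (2 * x1 + d)
          in Weierstrass b1 b2 b3 b4
              (y1\<^sup>2 + b1 * x1 * y1 + b3 * y1 - x1 ^ 3 - b2 * x1\<^sup>2 - b4 * x1))"
    using chord_parametrization .
  note eqs = *(2-4)[unfolded Let_def] x3 y3
  show ?thesis unfolding cubic.simps eqs weierstrass.sel power_one mult_1_right by Groebner_Basis.algebra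
qed

end

section \<open>Tangents: \<open>Q = P\<close> and \<open>Q = - P\<close>\<close>

context
  fixes E :: "'a::field weierstrass" and x y t w :: 'a
  assumes P: "cubic E (x, y, 1) = 0"
    and t: "t = 2 * y + a1 E * x + a3 E"
    and w: "w = 3 * x\<^sup>2 + 2 * a2 E * x + a4 E - a1 E * y"
begin

text \<open>The tangent slope is \<open>w / t\<close>. Trading \<open>b3\<close> and
  \<open>b4\<close> for \<open>t\<close> and \<open>w\<close>, and \<open>b6\<close> for the curve
  equation, leaves free parameters and no division.\<close>

lemma tangent_parametrization:
  obtains b1 b2 where
    "E = (let b3 = t - 2 * y - b1 * x;
              b4 = w - 3 * x\<^sup>2 - 2 * b2 * x + b1 * y
          in Weierstrass b1 b2 b3 b4 (y\<^sup>2 + b1 * x * y + b3 * y - x ^ 3 - b2 * x\<^sup>2 - b4 * x))"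
proof -
  obtain b1 b2 b3 b4 b6 where E: "E = Weierstrass b1 b2 b3 b4 b6" by (cases E)
  have "b3 = t - 2 * y - b1 * x" "b4 = w - 3 * x\<^sup>2 - 2 * b2 * x + b1 * y"
    by (simp_all add: t w E)
  moreover have "b6 = y\<^sup>2 + b1 * x * y + b3 * y - x ^ 3 - b2 * x\<^sup>2 - b4 * x"
    using P by (simp add: E algebra_simps)
  ultimately show ?thesis using that[of b1 b2] E by (simp add: Let_def)
qed

text \<open>For \<open>t\<close> nonzero, \<open>u\<close> and \<open>v\<close> are
  \<open>t^3\<close> times the coordinates of 2P, and the common factor is \<open>-t^3\<close>.
  Cleared of denominators, the identities also cover \<open>t = 0\<close>, where only the
  \<open>yy\<close> entry survives, with value \<open>w^3\<close>.\<close>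

lemma sd_tangent:
  defines "u \<equiv> t * (w\<^sup>2 + a1 E * w * t - (a2 E + 2 * x) * t\<^sup>2)"
  defines "v \<equiv> - y * t ^ 3 - w * (w\<^sup>2 + a1 E * w * t - (a2 E + 3 * x) * t\<^sup>2)
    - a1 E * u - a3 E * t ^ 3"
  defines "y' \<equiv> - y - a1 E * x - a3 E"
  shows
    "sd_xx E (x, y, 1) (x, y, 1) = 0" "sd_xx E (x, y, 1) (x, y', 1) = 0"
    "sd_xy E (x, y, 1) (x, y, 1) = - u" "sd_xy E (x, y, 1) (x, y', 1) = 0"
    "sd_xz E (x, y, 1) (x, y, 1) = 0" "sd_xz E (x, y, 1) (x, y', 1) = 0"
    "sd_yy E (x, y, 1) (x, y, 1) = - v" "sd_yy E (x, y, 1) (x, y', 1) = - v"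
    "sd_yz E (x, y, 1) (x, y, 1) = 0" "sd_yz E (x, y, 1) (x, y', 1) = - (t ^ 3)"
    "sd_zz E (x, y, 1) (x, y, 1) = 0" "sd_zz E (x, y, 1) (x, y', 1) = 0"
proof -
  obtain b1 b2 where *:
    "E = (let b3 = t - 2 * y - b1 * x;
              b4 = w - 3 * x\<^sup>2 - 2 * b2 * x + b1 * y
          in Weierstrass b1 b2 b3 b4 (y\<^sup>2 + b1 * x * y + b3 * y - x ^ 3 - b2 * x\<^sup>2 - b4 * x))"
    using tangent_parametrization .
  note eqs = u_def v_def y'_def *[unfolded Let_def] weierstrass.sel b8_def
    sd_xx.simps sd_xy.simps sd_xz.simps sd_yy.simps sd_yz.simps sd_zz.simps
  show "sd_xx E (x, y, 1) (x, y, 1) = 0" "sd_xx E (x, y, 1) (x, y', 1) = 0"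
    "sd_xy E (x, y, 1) (x, y, 1) = - u" "sd_xy E (x, y, 1) (x, y', 1) = 0"
    "sd_xz E (x, y, 1) (x, y, 1) = 0" "sd_xz E (x, y, 1) (x, y', 1) = 0"
    "sd_yy E (x, y, 1) (x, y, 1) = - v" "sd_yy E (x, y, 1) (x, y', 1) = - v"
    "sd_yz E (x, y, 1) (x, y, 1) = 0" "sd_yz E (x, y, 1) (x, y', 1) = - (t ^ 3)"
    "sd_zz E (x, y, 1) (x, y, 1) = 0" "sd_zz E (x, y, 1) (x, y', 1) = 0"
    unfolding eqs power_one mult_1_right by Groebner_Basis.algebra+
qed

lemma cubic_tangent:
  assumes "t \<noteq> 0" and l: "l = w / t"
    and x3: "x3 = l\<^sup>2 + a1 E * l - a2 E - x - x"
    and y3: "y3 = - (y + l * (x3 - x)) - a1 E * x3 - a3 E"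
  shows "cubic E (x3, y3, 1) = 0"
proof -
  \<comment> \<open>Replacing \<open>w\<close> by \<open>l * t\<close> makes the slope a free
    parameter and the claim a polynomial identity.\<close>
  have w': "w = l * t" using assms by simp
  obtain b1 b2 where *:
    "E = (let b3 = t - 2 * y - b1 * x;
              b4 = w - 3 * x\<^sup>2 - 2 * b2 * x + b1 * y
          in Weierstrass b1 b2 b3 b4 (y\<^sup>2 + b1 * x * y + b3 * y - x ^ 3 - b2 * x\<^sup>2 - b4 * x))"
    using tangent_parametrization .
  note eqs = *[unfolded Let_def] x3 y3 w'
  show ?thesis unfolding cubic.simps eqs weierstrass.sel power_one mult_1_right by Groebner_Basis.algebra
qed

end

section \<open>The addition law attached to a line\<close>

text \<open>The matrix applied to the coefficient vector \<open>(-m, 1, -c)\<close> of the line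
  \<open>y = m x + c z\<close>. Entries below the diagonal are those above it, evaluated at
  -Q.\<close>

fun line_law :: "'a::field weierstrass \<Rightarrow> 'a \<Rightarrow> 'a \<Rightarrow> 'a vec3 \<Rightarrow> 'a vec3 \<Rightarrow> 'a vec3" where
  "line_law E m c v w =
     (sd_xy E v w - m * sd_xx E v w - c * sd_xz E v w,
      sd_yy E v w - m * sd_xy E v (neg_vec E w) - c * sd_yz E v w,
      sd_yz E v (neg_vec E w) - m * sd_xz E v (neg_vec E w) - c * sd_zz E v w)"

fun line_value :: "'a::field \<Rightarrow> 'a \<Rightarrow> 'a vec3 \<Rightarrow> 'a" where
  "line_value m c (x, y, z) = y - m * x - c * z"

fun scale :: "'a::field \<Rightarrow> 'a vec3 \<Rightarrow> 'a vec3" where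
  "scale r (x, y, z) = (r * x, r * y, r * z)"

lemma neg_pt_in_points:
  assumes "P \<in> points E"
  shows "neg_pt E P \<in> points E"
  using assms by (cases "(E, P)" rule: neg_pt.cases)
    (auto simp: points_def algebra_simps power2_eq_square)

text \<open>The difference of the two curve equations factors into the two alternatives.\<close>

lemma same_abscissa:
  assumes "cubic E (x, y1, 1) = 0" "cubic E (x, y2, 1) = 0"
  shows "y2 = y1 \<or> y2 = - y1 - a1 E * x - a3 E"
proof -
  have "(y2 - y1) * (y2 - (- y1 - a1 E * x - a3 E)) = cubic E (x, y2, 1) - cubic E (x, y1, 1)"
    by (simp add: algebra_simps power2_eq_square)
  thus ?thesis using assms by (simp del: cubic.simps)
qed

lemma add_pt_in_points:
  assumes "P \<in> points E" "Q \<in> points E"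
  shows "add_pt E P Q \<in> points E"
proof (cases "(E, P, Q)" rule: add_pt.cases)
  case (3 E' x1 y1 x2 y2)
  hence PQ: "P = Some (x1, y1)" "Q = Some (x2, y2)" by auto
  hence P: "cubic E (x1, y1, 1) = 0" and Q: "cubic E (x2, y2, 1) = 0"
    using assms by (simp_all add: points_def del: cubic.simps)
  show ?thesis
  proof (cases "x1 = x2")
    case False
    thus ?thesis using cubic_chord[OF P Q False refl refl refl refl refl refl]
      by (simp add: PQ points_def Let_def del: cubic.simps)
  next
    case True
    show ?thesis
    proof (cases "y1 + y2 + a1 E * x2 + a3 E = 0")
      case True
      thus ?thesis using \<open>x1 = x2\<close> by (simp add: PQ points_def)
    next
      case False
      \<comment> \<open>With equal abscissas and Q different from -P, the points coincide, and the
        denominator of the tangent slope is nonzero.\<close>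
      have "y2 = y1" using same_abscissa[of E x1 y1 y2] P Q False \<open>x1 = x2\<close>
        by (auto simp del: cubic.simps)
      moreover from this have "2 * y1 + a1 E * x1 + a3 E \<noteq> 0" using False \<open>x1 = x2\<close> by simp
      ultimately show ?thesis
        using cubic_tangent[OF P refl refl _ refl refl refl] \<open>x1 = x2\<close> False
        by (simp add: PQ points_def Let_def del: cubic.simps)
    qed
  qed
qed (use assms in auto)

text \<open>The condition in \<open>elliptic_curve\<close> before base change, so that the formulas
  can be proved over any field.\<close>

abbreviation smooth :: "'a::field weierstrass \<Rightarrow> bool" where
  "smooth E \<equiv> (\<forall>v. v \<noteq> (0, 0, 0) \<and> cubic E v = 0 \<longrightarrow> cubic_gradient E v \<noteq> (0, 0, 0))"

text \<open>The two expressions are, up to sign, the partial derivatives in \<open>y\<close> and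
  \<open>x\<close>. If both vanished, Euler's relation would make the third vanish too, in every
  characteristic.\<close>

lemma smooth_affine:
  assumes "smooth E" "cubic E (x, y, 1) = 0" "2 * y + a1 E * x + a3 E = 0"
  shows "3 * x\<^sup>2 + 2 * a2 E * x + a4 E - a1 E * y \<noteq> 0"
proof
  assume w: "3 * x\<^sup>2 + 2 * a2 E * x + a4 E - a1 E * y = 0"
  obtain gx gy gz where g: "cubic_gradient E (x, y, 1) = (gx, gy, gz)"
    by (cases "cubic_gradient E (x, y, 1)")
  have "gx = 0" "gy = 0" using g w assms(3) by (auto simp: algebra_simps)
  moreover have "x * gx + y * gy + gz = 3 * cubic E (x, y, 1)" \<comment> \<open>Euler's relation\<close>
    using g by (auto simp: algebra_simps power2_eq_square power3_eq_cube)
  ultimately have "cubic_gradient E (x, y, 1) = (0, 0, 0)" using assms(2) g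
    by (simp del: cubic.simps cubic_gradient.simps)
  thus False using assms(1,2) by (auto simp del: cubic.simps cubic_gradient.simps)
qed

text \<open>Since \<open>r\<close> is nonzero, the law vanishes at (P, Q) exactly if P - Q lies on
  the line, and otherwise represents P + Q.\<close>

lemma line_law_eq:
  fixes E :: "'a::field weierstrass"
  assumes "smooth E" "P \<in> points E" "Q \<in> points E"
  shows "\<exists>r. r \<noteq> 0 \<and> line_law E m c (embed P) (embed Q)
    = scale (r * line_value m c (embed (add_pt E P (neg_pt E Q)))) (embed (add_pt E P Q))"
proof (cases P)
  case None
  show ?thesis
  proof (cases Q)
    case None
    show ?thesis by (rule exI[of _ "-1"]) (simp add: \<open>P = None\<close> None)
  next
    case (Some q)
    obtain x y where "q = (x, y)" by (cases q)
    thus ?thesis using \<open>P = None\<close> Some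
      by (intro exI[of _ 1]) (simp add: algebra_simps power2_eq_square)
  qed
next
  case (Some p)
  then obtain x1 y1 where P': "P = Some (x1, y1)" by (cases p) auto
  hence P: "cubic E (x1, y1, 1) = 0" using assms by (simp add: points_def del: cubic.simps)
  show ?thesis
  proof (cases Q)
    case None
    thus ?thesis using P'
      by (intro exI[of _ "-1"]) (simp add: algebra_simps power2_eq_square)
  next
    case (Some q)
    then obtain x2 y2 where Q': "Q = Some (x2, y2)" by (cases q) auto
    hence Q: "cubic E (x2, y2, 1) = 0" using assms by (simp add: points_def del: cubic.simps)
    define ny2 where "ny2 = - y2 - a1 E * x2 - a3 E"
    have nQ: "cubic E (x2, ny2, 1) = 0"
      using neg_pt_in_points[OF assms(3)] by (simp add: Q' points_def ny2_def del: cubic.simps)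
    show ?thesis
    proof (cases "x1 = x2")
      case False
      define l where "l = (y2 - y1) / (x2 - x1)"
      define k where "k = (ny2 - y1) / (x2 - x1)"
      define x3 where "x3 = l\<^sup>2 + a1 E * l - a2 E - x1 - x2"
      define y3 where "y3 = - (y1 + l * (x3 - x1)) - a1 E * x3 - a3 E"
      define x4 where "x4 = k\<^sup>2 + a1 E * k - a2 E - x1 - x2"
      define y4 where "y4 = - (y1 + k * (x4 - x1)) - a1 E * x4 - a3 E"
      have sum: "add_pt E P Q = Some (x3, y3)"
        using False by (simp add: P' Q' x3_def y3_def l_def Let_def)
      have diff: "add_pt E P (neg_pt E Q) = Some (x4, y4)"
        using False by (simp add: P' Q' x4_def y4_def k_def ny2_def Let_def)
      \<comment> \<open>As -(-Q) = Q, passing from Q to -Q exchanges the two slopes. The second use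
        of \<open>sd_chord\<close> therefore supplies the entries below the diagonal.\<close>
      have l: "l = (- ny2 - a1 E * x2 - a3 E - y1) / (x2 - x1)" by (simp add: l_def ny2_def)
      note sd = sd_chord[OF P Q False l_def k_def[unfolded ny2_def] x3_def y3_def x4_def y4_def]
        sd_chord[OF P nQ False k_def l x4_def y4_def x3_def y3_def]
      have neg: "neg_vec E (x2, y2, 1) = (x2, ny2, 1)" by (simp add: ny2_def)
      have "line_law E m c (embed P) (embed Q)
          = scale ((x1 - x2) ^ 3 * line_value m c (x4, y4, 1)) (x3, y3, 1)"
        unfolding P' Q' embed.simps line_law.simps neg sd by (simp add: algebra_simps)
      thus ?thesis using False unfolding sum diff by (intro exI[of _ "(x1 - x2) ^ 3"]) simp
    next
      case True
      define t where "t = 2 * y1 + a1 E * x1 + a3 E"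
      define w where "w = 3 * x1\<^sup>2 + 2 * a2 E * x1 + a4 E - a1 E * y1"
      define ny where "ny = - y1 - a1 E * x1 - a3 E"
      define x3 where "x3 = (w / t)\<^sup>2 + a1 E * (w / t) - a2 E - x1 - x1"
      define y3 where "y3 = - (y1 + w / t * (x3 - x1)) - a1 E * x3 - a3 E"
      have ny: "- ny - a1 E * x1 - a3 E = y1" by (simp add: ny_def)
      note sd = sd_tangent[OF P t_def w_def, folded ny_def]
      note sd_del = sd_xx.simps sd_xy.simps sd_xz.simps sd_yy.simps sd_yz.simps sd_zz.simps
      have neg: "neg_vec E (x1, y1, 1) = (x1, ny, 1)" "neg_vec E (x1, ny, 1) = (x1, y1, 1)"
        by (simp_all add: ny_def)
      have opposite: "add_pt E (Some (x1, y1)) (Some (x1, ny)) = None" by (simp add: ny_def)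
      show ?thesis
      proof (cases "t = 0")
        \<comment> \<open>P has order two, so Q = P = -P, and both sum and difference are O.
          Smoothness makes the factor \<open>w^3\<close> nonzero.\<close>
        case True
        have "y1 - ny = t" by (simp add: t_def ny_def algebra_simps)
        hence "ny = y1" using True by simp
        hence "y2 = y1" using same_abscissa[of E x1 y1 y2] P Q \<open>x1 = x2\<close> ny_def
          by (auto simp del: cubic.simps)
        have "w \<noteq> 0" using smooth_affine[OF assms(1) P] True by (simp add: t_def w_def)
        moreover have "line_law E m c (embed P) (embed Q) = (0, w ^ 3, 0)"
          unfolding P' Q'[folded \<open>x1 = x2\<close>, unfolded \<open>y2 = y1\<close>] embed.simps line_law.simps neg sd
          using True by (simp add: power2_eq_square power3_eq_cube)
        moreover have "add_pt E P Q = None" "add_pt E P (neg_pt E Q) = None"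
          unfolding P' Q'[folded \<open>x1 = x2\<close>, unfolded \<open>y2 = y1\<close>] neg_pt.simps ny_def[symmetric]
          using opposite \<open>ny = y1\<close> by (simp_all del: add_pt.simps)
        ultimately show ?thesis by (intro exI[of _ "w ^ 3"]) simp
      next
        case False
        have double: "add_pt E (Some (x1, y1)) (Some (x1, y1)) = Some (x3, y3)"
          using False by (simp add: x3_def y3_def t_def w_def Let_def)
        have x: "t * (w\<^sup>2 + a1 E * w * t - (a2 E + 2 * x1) * t\<^sup>2) = t ^ 3 * x3"
          using False by (simp add: x3_def field_simps power2_eq_square power3_eq_cube)
        have y: "- y1 * t ^ 3 - w * (w\<^sup>2 + a1 E * w * t - (a2 E + 3 * x1) * t\<^sup>2)
            - a1 E * (t ^ 3 * x3) - a3 E * t ^ 3 = t ^ 3 * y3"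
          using False by (simp add: x3_def y3_def field_simps power2_eq_square power3_eq_cube)
        note sd = sd[unfolded x y]
        \<comment> \<open>If Q = P, then P - Q = O, where the line takes the value 1; if Q = -P,
          then P + Q = O and P - Q = 2P.\<close>
        have "y2 = y1 \<or> y2 = ny" using same_abscissa[of E x1 y1 y2] P Q \<open>x1 = x2\<close> ny_def
          by (auto simp del: cubic.simps)
        thus ?thesis
        proof
          assume "y2 = y1"
          hence "line_law E m c (embed P) (embed Q) = scale (- (t ^ 3)) (x3, y3, 1)"
            unfolding P' Q'[folded \<open>x1 = x2\<close>] embed.simps line_law.simps
            by (simp add: neg sd del: neg_vec.simps sd_del)
          moreover have "add_pt E P Q = Some (x3, y3)" "add_pt E P (neg_pt E Q) = None"
            using double opposite \<open>x1 = x2\<close> \<open>y2 = y1\<close> ny_def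
            by (simp_all add: P' Q' del: add_pt.simps)
          ultimately show ?thesis using False by (intro exI[of _ "- (t ^ 3)"]) simp
        next
          assume "y2 = ny"
          hence "line_law E m c (embed P) (embed Q)
              = scale (- (t ^ 3) * line_value m c (x3, y3, 1)) (0, 1, 0)"
            unfolding P' Q'[folded \<open>x1 = x2\<close>] embed.simps line_law.simps
            by (simp add: neg sd algebra_simps del: neg_vec.simps sd_del)
          moreover have "add_pt E P Q = None" "add_pt E P (neg_pt E Q) = Some (x3, y3)"
            using double opposite \<open>x1 = x2\<close> \<open>y2 = ny\<close> ny
            by (simp_all add: P' Q' del: add_pt.simps)
          ultimately show ?thesis using False by (intro exI[of _ "- (t ^ 3)"]) simp
        qed
      qed
    qed
  qed
qed

section \<open>Functions given by bihomogeneous polynomials\<close>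

text \<open>Agreement is required for all vectors, not only on the curve, so that sums and products
  can be formed. The coefficients of the form lie in \<open>k\<close>, while the function lives over
  the closure.\<close>

definition representable ::
  "nat \<Rightarrow> nat \<Rightarrow> ('k::field alg_closure vec3 \<Rightarrow> 'k alg_closure vec3 \<Rightarrow> 'k alg_closure) \<Rightarrow> bool"
  where
  "representable m n F \<longleftrightarrow>
     (\<exists>f :: 'k bipoly. bihomogeneous m n f \<and> (\<forall>v w. bieval f v w = F v w))"

lemma bieval_superset:
  assumes "finite A" "Poly_Mapping.keys f \<subseteq> A"
  shows "bieval f v w = (\<Sum>(d, e) \<in> A.
           to_ac (Poly_Mapping.lookup f (d, e)) * monomial_value v d * monomial_value w e)"
  unfolding bieval_def using assms by (intro sum.mono_neutral_left) (auto simp: in_keys_iff)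

lemma bieval_add: "bieval (f + g) v w = bieval f v w + bieval g v w"
proof -
  let ?A = "Poly_Mapping.keys f \<union> Poly_Mapping.keys g"
  have "Poly_Mapping.keys (f + g) \<subseteq> ?A" by (rule keys_add)
  hence "bieval h v w = (\<Sum>(d, e) \<in> ?A.
      to_ac (Poly_Mapping.lookup h (d, e)) * monomial_value v d * monomial_value w e)"
    if "h \<in> {f + g, f, g}" for h
    using that by (intro bieval_superset) auto
  thus ?thesis
    by (simp add: lookup_add to_ac_add sum.distrib[symmetric] case_prod_unfold algebra_simps)
qed

lemma representable_zero: "representable m n (\<lambda>_ _. 0)"
  unfolding representable_def by (intro exI[of _ 0]) (simp add: bieval_def bihomogeneous_def)

lemma representable_monomial:
  assumes "total_degree d = m" "total_degree e = n"
  shows "representable m n (\<lambda>v w. to_ac c * monomial_value v d * monomial_value w e)"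
  unfolding representable_def using assms
  by (intro exI[of _ "Poly_Mapping.single (d, e) c"])
    (cases "c = 0"; auto simp: bieval_def bihomogeneous_def)

lemma representable_add:
  assumes "representable m n F" "representable m n G"
  shows "representable m n (\<lambda>v w. F v w + G v w)"
proof -
  obtain f g where "bihomogeneous m n f" "\<forall>v w. bieval f v w = F v w"
    "bihomogeneous m n g" "\<forall>v w. bieval g v w = G v w"
    using assms unfolding representable_def by blast
  thus ?thesis unfolding representable_def using keys_add[of f g]
    by (intro exI[of _ "f + g"]) (auto simp: bieval_add bihomogeneous_def)
qed

lemma representable_sum:
  assumes "\<And>i. i \<in> I \<Longrightarrow> representable m n (F i)"
  shows "representable m n (\<lambda>v w. \<Sum>i\<in>I. F i v w)"
  using assms
  by (induction I rule: infinite_finite_induct) (simp_all add: representable_zero representable_add)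

lemma total_degree_add: "total_degree (d + d') = total_degree d + total_degree d'"
  by (cases d; cases d') auto

lemma monomial_value_add: "monomial_value v (d + d') = monomial_value v d * monomial_value v d'"
  by (cases v; cases d; cases d') (auto simp: power_add)

text \<open>Expanding the product of the two sums adds exponents. Stating the degree equations as
  premises lets the rule apply while the degrees of the factors are still unknown.\<close>

lemma representable_mult:
  assumes "representable m n F" "representable m' n' G" "m + m' = M" "n + n' = N"
  shows "representable M N (\<lambda>v w. F v w * G v w)"
proof -
  obtain f where f: "bihomogeneous m n f" and F: "\<And>v w. bieval f v w = F v w"
    using assms(1) unfolding representable_def by blast
  obtain g where g: "bihomogeneous m' n' g" and G: "\<And>v w. bieval g v w = G v w"
    using assms(2) unfolding representable_def by blast
  have "representable M N (\<lambda>v w. \<Sum>i\<in>Poly_Mapping.keys f. \<Sum>j\<in>Poly_Mapping.keys g.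
      to_ac (Poly_Mapping.lookup f i * Poly_Mapping.lookup g j)
        * monomial_value v (fst i + fst j) * monomial_value w (snd i + snd j))"
    using f g assms(3,4)
    by (intro representable_sum representable_monomial)
      (fastforce simp: bihomogeneous_def total_degree_add)+
  thus ?thesis
    by (simp add: F[symmetric] G[symmetric] bieval_def sum_product case_prod_unfold to_ac_mult
        monomial_value_add mult_ac)
qed

lemma monomial_value_unit:
  "monomial_value v (0, 0, 0) = 1" "monomial_value v (Suc 0, 0, 0) = fst v"
  "monomial_value v (0, Suc 0, 0) = fst (snd v)" "monomial_value v (0, 0, Suc 0) = snd (snd v)"
  by (cases v, simp)+

lemma representable_const:
  assumes "m = 0" "n = 0"
  shows "representable m n (\<lambda>v w. to_ac c)"
  using representable_monomial[of "(0, 0, 0)" 0 "(0, 0, 0)" 0 c] assms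
  by (simp add: monomial_value_unit)

lemma representable_numeral:
  assumes "m = 0" "n = 0"
  shows "representable m n (\<lambda>v w. numeral k)"
  using representable_const[OF assms, of "numeral k"] by (simp add: to_ac_numeral)

lemma representable_uminus:
  assumes "representable m n F"
  shows "representable m n (\<lambda>v w. - F v w)"
  using representable_mult[OF representable_const[of 0 0 "-1"] assms refl refl]
  by (simp add: to_ac_minus)

lemma representable_diff:
  assumes "representable m n F" "representable m n G"
  shows "representable m n (\<lambda>v w. F v w - G v w)"
  using representable_add[OF assms(1) representable_uminus[OF assms(2)]] by simp

lemma representable_power:
  assumes "representable m n F" "k * m = M" "k * n = N"
  shows "representable M N (\<lambda>v w. F v w ^ k)"
proof -
  have "representable (k * m) (k * n) (\<lambda>v w. F v w ^ k)"
  proof (induction k)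
    case 0
    show ?case using representable_const[of 0 0 1] by simp
  next
    case (Suc k)
    show ?case using representable_mult[OF assms(1) Suc] by simp
  qed
  thus ?thesis using assms by simp
qed

lemma representable_coordinates:
  shows "m = 1 \<Longrightarrow> n = 0 \<Longrightarrow> representable m n (\<lambda>v w. fst v)"
    "m = 1 \<Longrightarrow> n = 0 \<Longrightarrow> representable m n (\<lambda>v w. fst (snd v))"
    "m = 1 \<Longrightarrow> n = 0 \<Longrightarrow> representable m n (\<lambda>v w. snd (snd v))"
    "m = 0 \<Longrightarrow> n = 1 \<Longrightarrow> representable m n (\<lambda>v w. fst w)"
    "m = 0 \<Longrightarrow> n = 1 \<Longrightarrow> representable m n (\<lambda>v w. fst (snd w))"
    "m = 0 \<Longrightarrow> n = 1 \<Longrightarrow> representable m n (\<lambda>v w. snd (snd w))"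
proof -
  note mono = representable_monomial[of _ m _ n 1, simplified to_ac_1 mult_1_left]
  show "m = 1 \<Longrightarrow> n = 0 \<Longrightarrow> representable m n (\<lambda>v w. fst v)"
    using mono[of "(1, 0, 0)" "(0, 0, 0)"] by (simp add: monomial_value_unit)
  show "m = 1 \<Longrightarrow> n = 0 \<Longrightarrow> representable m n (\<lambda>v w. fst (snd v))"
    using mono[of "(0, 1, 0)" "(0, 0, 0)"] by (simp add: monomial_value_unit)
  show "m = 1 \<Longrightarrow> n = 0 \<Longrightarrow> representable m n (\<lambda>v w. snd (snd v))"
    using mono[of "(0, 0, 1)" "(0, 0, 0)"] by (simp add: monomial_value_unit)
  show "m = 0 \<Longrightarrow> n = 1 \<Longrightarrow> representable m n (\<lambda>v w. fst w)"
    using mono[of "(0, 0, 0)" "(1, 0, 0)"] by (simp add: monomial_value_unit)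
  show "m = 0 \<Longrightarrow> n = 1 \<Longrightarrow> representable m n (\<lambda>v w. fst (snd w))"
    using mono[of "(0, 0, 0)" "(0, 1, 0)"] by (simp add: monomial_value_unit)
  show "m = 0 \<Longrightarrow> n = 1 \<Longrightarrow> representable m n (\<lambda>v w. snd (snd w))"
    using mono[of "(0, 0, 0)" "(0, 0, 1)"] by (simp add: monomial_value_unit)
qed

lemma representable_cong:
  assumes "\<And>v w. F v w = G v w" "representable m n G"
  shows "representable m n F"
  using assms unfolding representable_def by simp

lemmas representable_intros =
  representable_coordinates representable_const representable_numeral
  representable_add representable_diff representable_uminus representable_mult representable_power

text \<open>The defining equations match only explicit triples; these versions hold for vector
  variables and expose the coordinates to the closure rules.\<close>

lemmas sd_projections =
  sd_xx.simps[of E "fst v" "fst (snd v)" "snd (snd v)" "fst w" "fst (snd w)" "snd (snd w)",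
    unfolded prod.collapse]
  sd_xy.simps[of E "fst v" "fst (snd v)" "snd (snd v)" "fst w" "fst (snd w)" "snd (snd w)",
    unfolded prod.collapse]
  sd_xz.simps[of E "fst v" "fst (snd v)" "snd (snd v)" "fst w" "fst (snd w)" "snd (snd w)",
    unfolded prod.collapse]
  sd_yy.simps[of E "fst v" "fst (snd v)" "snd (snd v)" "fst w" "fst (snd w)" "snd (snd w)",
    unfolded prod.collapse]
  sd_yz.simps[of E "fst v" "fst (snd v)" "snd (snd v)" "fst w" "fst (snd w)" "snd (snd w)",
    unfolded prod.collapse]
  sd_zz.simps[of E "fst v" "fst (snd v)" "snd (snd v)" "fst w" "fst (snd w)" "snd (snd w)",
    unfolded prod.collapse]
  for E v w

lemma neg_vec_projections:
  "neg_vec E w = (fst w, - fst (snd w) - a1 E * fst w - a3 E * snd (snd w), snd (snd w))"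
  by (cases w) simp

lemma b8_base_change: "b8 (base_change E) = to_ac (b8 E)"
  by (simp add: b8_def weierstrass.map_sel to_ac_add to_ac_diff to_ac_mult to_ac_power to_ac_numeral)

text \<open>Unfolded, each entry is built from coordinates, numerals and constants from
  \<open>k\<close>, and the closure rules follow its syntax. The last three are the entries below
  the diagonal.\<close>

lemma representable_sd:
  "representable 2 2 (\<lambda>v w. sd_xx (base_change E) v w)"
  "representable 2 2 (\<lambda>v w. sd_xy (base_change E) v w)"
  "representable 2 2 (\<lambda>v w. sd_xz (base_change E) v w)"
  "representable 2 2 (\<lambda>v w. sd_yy (base_change E) v w)"
  "representable 2 2 (\<lambda>v w. sd_yz (base_change E) v w)"
  "representable 2 2 (\<lambda>v w. sd_zz (base_change E) v w)"
  "representable 2 2 (\<lambda>v w. sd_xy (base_change E) v (neg_vec (base_change E) w))"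
  "representable 2 2 (\<lambda>v w. sd_xz (base_change E) v (neg_vec (base_change E) w))"
  "representable 2 2 (\<lambda>v w. sd_yz (base_change E) v (neg_vec (base_change E) w))"
  by ((rule representable_cong, rule sd_projections,
      unfold neg_vec_projections fst_conv snd_conv b8_base_change weierstrass.map_sel,
      (rule representable_intros refl | (simp; fail))+)[1])+

section \<open>Base change and the complete law\<close>

lemma cubic_base_change:
  "cubic (base_change E) (to_ac x, to_ac y, to_ac z) = to_ac (cubic E (x, y, z))"
  by (simp add: weierstrass.map_sel to_ac_add to_ac_diff to_ac_mult to_ac_power)

lemma to_ac_pt_in_points_iff: "to_ac_pt P \<in> points (base_change E) \<longleftrightarrow> P \<in> points E"
proof (cases P)
  case None
  thus ?thesis by (simp add: points_def)
next
  case (Some p)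
  obtain x y where "p = (x, y)" by (cases p)
  thus ?thesis using Some cubic_base_change[of E x y 1]
    by (simp add: points_def to_ac_1 to_ac_eq_0_iff del: cubic.simps)
qed

lemma add_pt_base_change:
  "add_pt (base_change E) (to_ac_pt P) (to_ac_pt Q) = to_ac_pt (add_pt E P Q)"
proof (cases "(E, P, Q)" rule: add_pt.cases)
  case (3 E' x1 y1 x2 y2)
  \<comment> \<open>The embedding of \<open>k\<close> is injective, so the case distinction of
    \<open>add_pt\<close> has the same outcome over \<open>k\<close> and over its closure.\<close>
  moreover have "to_ac y1 + to_ac y2 + to_ac (a1 E) * to_ac x2 + to_ac (a3 E) = 0
      \<longleftrightarrow> y1 + y2 + a1 E * x2 + a3 E = 0"
    by (simp only: to_ac_add[symmetric] to_ac_mult[symmetric] to_ac_eq_0_iff)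
  ultimately show ?thesis
    by (simp add: weierstrass.map_sel Let_def to_ac_eq_iff to_ac_add to_ac_diff to_ac_mult to_ac_power
        to_ac_divide to_ac_numeral to_ac_minus)
qed auto

lemma neg_pt_base_change: "neg_pt (base_change E) (to_ac_pt P) = to_ac_pt (neg_pt E P)"
  by (cases "(E, P)" rule: neg_pt.cases)
    (auto simp: weierstrass.map_sel to_ac_diff to_ac_mult to_ac_minus)

text \<open>That \<open>u\<close> is nonzero rules out both \<open>r = 0\<close> and
  \<open>v = 0\<close>; the scalar from \<open>u\<close> back to \<open>v\<close> is
  \<open>1 / r\<close>.\<close>

lemma proj_eq_scale:
  assumes "u = scale r v" "u \<noteq> (0, 0, 0)"
  shows "proj_eq v u"
proof -
  obtain x y z where "v = (x, y, z)" by (cases v)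
  thus ?thesis using assms unfolding proj_eq_def
    by (auto intro!: exI[of _ "inverse r"])
qed

lemma embed_nonzero: "embed P \<noteq> (0, 0, 0)"
  by (cases P rule: embed.cases) auto

theorem theorem3:
  fixes E :: "'k::{field, finite} weierstrass"
  assumes "CARD('k) \<ge> 5"
    and "elliptic_curve E"
  shows "\<exists>p. addition_law E 2 2 p \<and> complete_law E p"
proof -
  obtain m c where mc: "\<And>x. Some (x, m * x + c) \<notin> points E"
    using exists_line_missing_curve[OF assms(1)] by blast
  let ?E = "base_change E"
  let ?L = "line_law ?E (to_ac m) (to_ac c)"
  have smooth: "smooth ?E" using assms(2) unfolding elliptic_curve_def .
  \<comment> \<open>Because \<open>m\<close> and \<open>c\<close> lie in \<open>k\<close>, the
    components of the law are given by forms over \<open>k\<close>.\<close>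
  have "representable 2 2 (\<lambda>v w. fst (?L v w))" "representable 2 2 (\<lambda>v w. fst (snd (?L v w)))"
    "representable 2 2 (\<lambda>v w. snd (snd (?L v w)))"
    unfolding line_law.simps fst_conv snd_conv
    by (rule representable_sd representable_diff representable_mult representable_const refl
        | (simp; fail))+
  then obtain p0 p1 p2 :: "'k bipoly" where
    p: "bihomogeneous 2 2 p0" "bihomogeneous 2 2 p1" "bihomogeneous 2 2 p2"
    and ev: "\<And>v w. (bieval p0 v w, bieval p1 v w, bieval p2 v w) = ?L v w"
    unfolding representable_def by (metis prod.collapse)
  \<comment> \<open>The locus where the three components do not all vanish; it is open by definition
    and serves every rational pair at once.\<close>
  define U where "U = {(P, Q) \<in> points ?E \<times> points ?E. ?L (embed P) (embed Q) \<noteq> (0, 0, 0)}"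
  have "zariski_open E U"
    unfolding zariski_open_def U_def using p
    by (intro exI[of _ "{p0, p1, p2}"]) (auto simp: ev[symmetric] simp del: line_law.simps)
  moreover have "proj_eq (embed (add_pt ?E P Q)) (?L (embed P) (embed Q))" if "(P, Q) \<in> U" for P Q
    using line_law_eq[OF smooth, of P Q "to_ac m" "to_ac c"] that
    by (auto simp: U_def intro: proj_eq_scale simp del: line_law.simps)
  ultimately have defined: "defined_on E (p0, p1, p2) U" if "U \<noteq> {}"
    using that unfolding defined_on_def by (auto simp: ev simp del: line_law.simps)
  \<comment> \<open>For rational P and Q the difference P - Q is again rational. It misses the line
    by the choice of \<open>m\<close> and \<open>c\<close> if it is affine, and because the line
    takes the value 1 at O otherwise.\<close>
  have rational: "(to_ac_pt P, to_ac_pt Q) \<in> U" if P: "P \<in> points E" and Q: "Q \<in> points E" for P Q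
  proof -
    let ?R = "add_pt E P (neg_pt E Q)"
    have "?R \<in> points E" by (intro add_pt_in_points neg_pt_in_points P Q)
    hence "line_value (to_ac m) (to_ac c) (embed (to_ac_pt ?R)) \<noteq> 0"
    proof (cases ?R)
      case (Some r)
      obtain x y where r: "r = (x, y)" by (cases r)
      have "y \<noteq> m * x + c" using mc[of x] \<open>?R \<in> points E\<close> Some r by auto
      hence "y - m * x - c \<noteq> 0" by (simp add: algebra_simps)
      moreover have "line_value (to_ac m) (to_ac c) (embed (to_ac_pt ?R)) = to_ac (y - m * x - c)"
        using Some r by (simp add: to_ac_diff to_ac_mult)
      ultimately show ?thesis by (simp only: to_ac_eq_0_iff not_False_eq_True)
    qed simp
    hence "?L (embed (to_ac_pt P)) (embed (to_ac_pt Q)) \<noteq> (0, 0, 0)"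
      using line_law_eq[OF smooth, of "to_ac_pt P" "to_ac_pt Q" "to_ac m" "to_ac c"] P Q
        embed_nonzero[of "add_pt ?E (to_ac_pt P) (to_ac_pt Q)"]
      by (cases "embed (add_pt ?E (to_ac_pt P) (to_ac_pt Q))")
        (auto simp: to_ac_pt_in_points_iff neg_pt_base_change add_pt_base_change
          simp del: line_law.simps)
    thus ?thesis using P Q by (simp add: U_def to_ac_pt_in_points_iff del: line_law.simps)
  qed
  have "U \<noteq> {}" using rational[of None None] by (auto simp: points_def)
  hence "defined_on E (p0, p1, p2) U" by (rule defined)
  hence "addition_law E 2 2 (p0, p1, p2) \<and> complete_law E (p0, p1, p2)"
    unfolding addition_law_def complete_law_def using p rational by blast
  thus ?thesis by blast
qed

end
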